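(* Let $R$ be a ring, let ${}_RM$ be a finitely generated semisimple (unitary) left $R$-module, and let $\varphi:M\longrightarrow M$ be a nilpotent $R$-endomorphism. Then there exists a subset $\{x_i^{(t)}\mid 1\leq t\leq r,\ 1\leq i\leq k_t\}$ of $M$ (for some positive integers $r,k_1,\dots,k_r$) such that each $R$-submodule $Rx_i^{(t)}\leq M$ is simple, $$\bigoplus_{1\leq t\leq r,\ 1\leq i\leq k_t}Rx_i^{(t)}=M$$ is a direct sum, and $\varphi(x_i^{(t)})=x_{i-1}^{(t)}$, $\varphi(x_1^{(t)})=0$ for all $1\leq t\leq r$ and $2\leq i\leq k_t$.
   Context: Rings are associative with identity, not necessarily commutative, and modules are unitary. An endomorphism $\varphi$ is nilpotent if $\varphi^{k}=0\neq\varphi^{k-1}$ for some integer $k\geq 1$, with $\varphi^0$ the identity (in particular $M\neq 0$). The direct sum is an internal direct sum of submodules of $M$ indexed by the pairs $(t,i)$. *)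

theory Defs
  imports "HOL-Algebra.Module"
begin

(* The locale module of HOL-Algebra requires a commutative ring of scalars.  Here the ring is
   arbitrary; the module axioms are the same.  The library's locale submodule does not mention
   commutativity and is used unchanged. *)
locale left_module = R?: ring R + M?: abelian_group M for R and M (structure) +
  assumes smult_closed [simp, intro]:
      "\<lbrakk>a \<in> carrier R; x \<in> carrier M\<rbrakk> \<Longrightarrow> a \<odot>\<^bsub>M\<^esub> x \<in> carrier M"
    and smult_l_distr:
      "\<lbrakk>a \<in> carrier R; b \<in> carrier R; x \<in> carrier M\<rbrakk> \<Longrightarrow>
        (a \<oplus>\<^bsub>R\<^esub> b) \<odot>\<^bsub>M\<^esub> x = a \<odot>\<^bsub>M\<^esub> x \<oplus>\<^bsub>M\<^esub> b \<odot>\<^bsub>M\<^esub> x"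
    and smult_r_distr:
      "\<lbrakk>a \<in> carrier R; x \<in> carrier M; y \<in> carrier M\<rbrakk> \<Longrightarrow>
        a \<odot>\<^bsub>M\<^esub> (x \<oplus>\<^bsub>M\<^esub> y) = a \<odot>\<^bsub>M\<^esub> x \<oplus>\<^bsub>M\<^esub> a \<odot>\<^bsub>M\<^esub> y"
    and smult_assoc:
      "\<lbrakk>a \<in> carrier R; b \<in> carrier R; x \<in> carrier M\<rbrakk> \<Longrightarrow>
        (a \<otimes>\<^bsub>R\<^esub> b) \<odot>\<^bsub>M\<^esub> x = a \<odot>\<^bsub>M\<^esub> (b \<odot>\<^bsub>M\<^esub> x)"
    and smult_one [simp]:
      "x \<in> carrier M \<Longrightarrow> \<one>\<^bsub>R\<^esub> \<odot>\<^bsub>M\<^esub> x = x"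

definition submodule_span ::
    "('a, 'r) ring_scheme \<Rightarrow> ('a, 'm, 'x) module_scheme \<Rightarrow> 'm set \<Rightarrow> 'm set" where
  "submodule_span R M S = \<Inter>{H. submodule H R M \<and> S \<subseteq> H}"

definition finitely_generated_module ::
    "('a, 'r) ring_scheme \<Rightarrow> ('a, 'm, 'x) module_scheme \<Rightarrow> bool" where
  "finitely_generated_module R M \<longleftrightarrow>
     (\<exists>S. finite S \<and> S \<subseteq> carrier M \<and> submodule_span R M S = carrier M)"

definition cyclic_submodule ::
    "('a, 'r) ring_scheme \<Rightarrow> ('a, 'm, 'x) module_scheme \<Rightarrow> 'm \<Rightarrow> 'm set" where
  "cyclic_submodule R M x = {a \<odot>\<^bsub>M\<^esub> x | a. a \<in> carrier R}"

definition simple_submodule ::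
    "('a, 'r) ring_scheme \<Rightarrow> ('a, 'm, 'x) module_scheme \<Rightarrow> 'm set \<Rightarrow> bool" where
  "simple_submodule R M S \<longleftrightarrow>
     submodule S R M \<and> S \<noteq> {\<zero>\<^bsub>M\<^esub>} \<and>
     (\<forall>H. submodule H R M \<longrightarrow> H \<subseteq> S \<longrightarrow> H = {\<zero>\<^bsub>M\<^esub>} \<or> H = S)"

(* M is the internal direct sum of the family (N i), i in I, of submodules.  The index set I may
   be infinite; the sum of a family of submodules is the submodule spanned by their union. *)
definition internal_direct_sum ::
    "('a, 'r) ring_scheme \<Rightarrow> ('a, 'm, 'x) module_scheme \<Rightarrow> ('i \<Rightarrow> 'm set) \<Rightarrow> 'i set \<Rightarrow> bool" where
  "internal_direct_sum R M N I \<longleftrightarrow>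
     (\<forall>i\<in>I. submodule (N i) R M) \<and>
     submodule_span R M (\<Union>i\<in>I. N i) = carrier M \<and>
     (\<forall>i\<in>I. N i \<inter> submodule_span R M (\<Union>j\<in>I - {i}. N j) = {\<zero>\<^bsub>M\<^esub>})"

(* Indexing the summands by themselves loses nothing: two equal summands of a direct sum are
   zero, hence not simple. *)
definition semisimple_module ::
    "('a, 'r) ring_scheme \<Rightarrow> ('a, 'm, 'x) module_scheme \<Rightarrow> bool" where
  "semisimple_module R M \<longleftrightarrow>
     (\<exists>\<S>. (\<forall>S\<in>\<S>. simple_submodule R M S) \<and> internal_direct_sum R M (\<lambda>S. S) \<S>)"

definition module_endomorphism ::
    "('a, 'r) ring_scheme \<Rightarrow> ('a, 'm, 'x) module_scheme \<Rightarrow> ('m \<Rightarrow> 'm) \<Rightarrow> bool" where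
  "module_endomorphism R M \<phi> \<longleftrightarrow>
     \<phi> \<in> hom (add_monoid M) (add_monoid M) \<and>
     (\<forall>a\<in>carrier R. \<forall>x\<in>carrier M. \<phi> (a \<odot>\<^bsub>M\<^esub> x) = a \<odot>\<^bsub>M\<^esub> \<phi> x)"

(* Only the values on the carrier matter, so a power of \<phi> is zero if it vanishes on the carrier.
   The second conjunct forces M to be nonzero. *)
definition nilpotent_on_module :: "('a, 'm, 'x) module_scheme \<Rightarrow> ('m \<Rightarrow> 'm) \<Rightarrow> bool" where
  "nilpotent_on_module M \<phi> \<longleftrightarrow>
     (\<exists>k\<ge>1. (\<forall>x\<in>carrier M. (\<phi> ^^ k) x = \<zero>\<^bsub>M\<^esub>) \<and>
            \<not> (\<forall>x\<in>carrier M. (\<phi> ^^ (k - 1)) x = \<zero>\<^bsub>M\<^esub>))"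

end

theory Submission
  imports Defs
begin

text \<open>
  Call \<open>x\<close> a simple vector if \<open>R x\<close> is a simple submodule.  If \<open>x\<close> is a simple vector and \<open>N\<close> a
  submodule, then either \<open>x \<in> N\<close> or \<open>R x\<close> meets \<open>N\<close> only in zero.  Hence simple vectors satisfy the
  exchange property of linear algebra (\<open>span_exchange\<close>) although \<open>R\<close> is not a field: by Zorn's lemma,
  families of simple vectors that are independent over a submodule \<open>N\<close> extend to bases over \<open>N\<close>
  (\<open>independent_extend\<close>).  Semisimplicity enters only through the fact that each submodule of \<open>M\<close>
  is again spanned by its simple vectors (\<open>submodule_span_simple_vectors\<close>).

  With these tools the classical construction of a nilpotent Jordan basis applies.  Let \<open>K n\<close> be the
  kernel of \<open>\<phi>\<close> to the power \<open>n\<close>.  A basis \<open>A\<close> of \<open>K (n + 1)\<close> over \<open>K n\<close> is mapped by \<open>\<phi>\<close> injectively to a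
  family of simple vectors in \<open>K n\<close> that is independent over \<open>K (n - 1)\<close>
  (\<open>independent_over_kernel_image\<close>), so this image extends to a basis of \<open>K n\<close> over \<open>K (n - 1)\<close>, and so on
  down to \<open>K 0 = 0\<close>.  The union \<open>B\<close> of the families obtained is a basis of \<open>M\<close> which \<open>\<phi>\<close> maps into
  \<open>B \<union> {0}\<close>, injectively where the image is not zero (\<open>chain_closed_basis_of_kernel\<close>).

  Finite generation makes \<open>B\<close> finite (\<open>finite_independent_span\<close>).  The graph of \<open>\<phi>\<close> on such a set is a
  disjoint union of paths, each ending in zero because \<open>\<phi>\<close> is nilpotent and starting at an
  element of \<open>B\<close> outside \<open>\<phi> ` B\<close>; numbering every path from its last nonzero element backwards
  gives the required vectors.
\<close>

section \<open>Submodules and spans\<close>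

context left_module
begin

abbreviation span :: "'c set \<Rightarrow> 'c set" where
  "span X \<equiv> submodule_span R M X"

lemma smult_zero_left [simp]:
  assumes x: "x \<in> carrier M"
  shows "\<zero>\<^bsub>R\<^esub> \<odot>\<^bsub>M\<^esub> x = \<zero>\<^bsub>M\<^esub>"
proof -
  have "\<zero>\<^bsub>R\<^esub> \<odot>\<^bsub>M\<^esub> x \<oplus>\<^bsub>M\<^esub> \<zero>\<^bsub>R\<^esub> \<odot>\<^bsub>M\<^esub> x = \<zero>\<^bsub>R\<^esub> \<odot>\<^bsub>M\<^esub> x"
    using smult_l_distr[of "\<zero>\<^bsub>R\<^esub>" "\<zero>\<^bsub>R\<^esub>" x] x by simp
  then show ?thesis
    using x by (metis M.add.r_cancel_one' R.zero_closed smult_closed)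
qed

lemma smult_zero_right [simp]:
  assumes a: "a \<in> carrier R"
  shows "a \<odot>\<^bsub>M\<^esub> \<zero>\<^bsub>M\<^esub> = \<zero>\<^bsub>M\<^esub>"
proof -
  have "a \<odot>\<^bsub>M\<^esub> \<zero>\<^bsub>M\<^esub> \<oplus>\<^bsub>M\<^esub> a \<odot>\<^bsub>M\<^esub> \<zero>\<^bsub>M\<^esub> = a \<odot>\<^bsub>M\<^esub> \<zero>\<^bsub>M\<^esub>"
    using smult_r_distr[of a "\<zero>\<^bsub>M\<^esub>" "\<zero>\<^bsub>M\<^esub>"] a by simp
  then show ?thesis
    using a by (metis M.add.r_cancel_one' M.zero_closed smult_closed)
qed

lemma smult_minus_one:
  assumes x: "x \<in> carrier M"
  shows "(\<ominus>\<^bsub>R\<^esub> \<one>\<^bsub>R\<^esub>) \<odot>\<^bsub>M\<^esub> x = \<ominus>\<^bsub>M\<^esub> x"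
proof -
  have "(\<ominus>\<^bsub>R\<^esub> \<one>\<^bsub>R\<^esub>) \<odot>\<^bsub>M\<^esub> x \<oplus>\<^bsub>M\<^esub> x = \<zero>\<^bsub>M\<^esub>"
    using smult_l_distr[of "\<ominus>\<^bsub>R\<^esub> \<one>\<^bsub>R\<^esub>" "\<one>\<^bsub>R\<^esub>" x] x by (simp add: R.l_neg)
  then show ?thesis
    using x by (metis M.minus_equality R.a_inv_closed R.one_closed smult_closed)
qed

lemma add_diff_cancel_right:
  assumes "p \<in> carrier M" "w \<in> carrier M"
  shows "(p \<oplus>\<^bsub>M\<^esub> w) \<ominus>\<^bsub>M\<^esub> w = p"
  using assms by (simp add: M.minus_eq M.a_assoc M.r_neg)

lemma diff_add_cancel_right:
  assumes "p \<in> carrier M" "w \<in> carrier M"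
  shows "(p \<ominus>\<^bsub>M\<^esub> w) \<oplus>\<^bsub>M\<^esub> w = p"
  using assms by (simp add: M.minus_eq M.a_assoc M.l_neg)

lemma submoduleI:
  assumes "H \<subseteq> carrier M" and zero: "\<zero>\<^bsub>M\<^esub> \<in> H"
    and add: "\<And>x y. x \<in> H \<Longrightarrow> y \<in> H \<Longrightarrow> x \<oplus>\<^bsub>M\<^esub> y \<in> H"
    and smult: "\<And>a x. a \<in> carrier R \<Longrightarrow> x \<in> H \<Longrightarrow> a \<odot>\<^bsub>M\<^esub> x \<in> H"
  shows "submodule H R M"
proof -
  have "\<ominus>\<^bsub>M\<^esub> x \<in> H" if "x \<in> H" for x
    using smult[of "\<ominus>\<^bsub>R\<^esub> \<one>\<^bsub>R\<^esub>" x] smult_minus_one[of x] that assms(1) by auto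
  then show ?thesis
    using assms
    by (intro submodule.intro subgroup.intro) (auto simp: submodule_axioms_def a_inv_def)
qed

lemma submoduleD:
  assumes "submodule H R M"
  shows submodule_carrier: "H \<subseteq> carrier M"
    and submodule_zero: "\<zero>\<^bsub>M\<^esub> \<in> H"
    and submodule_add: "\<And>x y. x \<in> H \<Longrightarrow> y \<in> H \<Longrightarrow> x \<oplus>\<^bsub>M\<^esub> y \<in> H"
    and submodule_smult: "\<And>a x. a \<in> carrier R \<Longrightarrow> x \<in> H \<Longrightarrow> a \<odot>\<^bsub>M\<^esub> x \<in> H"
    and submodule_diff: "\<And>x y. x \<in> H \<Longrightarrow> y \<in> H \<Longrightarrow> x \<ominus>\<^bsub>M\<^esub> y \<in> H"
proof -
  have sub: "subgroup H (add_monoid M)"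
    using assms by (simp add: submodule_def)
  show carr: "H \<subseteq> carrier M" and "\<zero>\<^bsub>M\<^esub> \<in> H"
    and add: "\<And>x y. x \<in> H \<Longrightarrow> y \<in> H \<Longrightarrow> x \<oplus>\<^bsub>M\<^esub> y \<in> H"
    using subgroup.subset[OF sub] subgroup.one_closed[OF sub] subgroup.m_closed[OF sub] by auto
  show smult: "\<And>a x. a \<in> carrier R \<Longrightarrow> x \<in> H \<Longrightarrow> a \<odot>\<^bsub>M\<^esub> x \<in> H"
    using submodule.smult_closed[OF assms] by auto
  have "\<ominus>\<^bsub>M\<^esub> y \<in> H" if "y \<in> H" for y
    using smult[of "\<ominus>\<^bsub>R\<^esub> \<one>\<^bsub>R\<^esub>" y] smult_minus_one[of y] that carr by auto
  then show "\<And>x y. x \<in> H \<Longrightarrow> y \<in> H \<Longrightarrow> x \<ominus>\<^bsub>M\<^esub> y \<in> H"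
    using add carr by (auto simp: M.minus_eq)
qed

lemma submodule_carrier_self: "submodule (carrier M) R M"
  by (rule submoduleI) auto

lemma span_superset: "X \<subseteq> span X"
  by (auto simp: submodule_span_def)

lemma span_mono: "X \<subseteq> Y \<Longrightarrow> span X \<subseteq> span Y"
  by (auto simp: submodule_span_def)

lemma span_least: "submodule H R M \<Longrightarrow> X \<subseteq> H \<Longrightarrow> span X \<subseteq> H"
  by (auto simp: submodule_span_def)

lemma span_submodule:
  assumes "X \<subseteq> carrier M"
  shows "submodule (span X) R M"
proof (rule submoduleI)
  show "span X \<subseteq> carrier M"
    using span_least[OF submodule_carrier_self assms] .
qed (auto simp: submodule_span_def intro: submodule_zero submodule_add submodule_smult)

lemma span_carrier: "X \<subseteq> carrier M \<Longrightarrow> span X \<subseteq> carrier M"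
  using span_least[OF submodule_carrier_self] .

lemma span_subset_span:
  assumes "Y \<subseteq> carrier M" "X \<subseteq> span Y"
  shows "span X \<subseteq> span Y"
  using span_least[OF span_submodule[OF assms(1)] assms(2)] .

lemma span_of_submodule: "submodule H R M \<Longrightarrow> span H = H"
  using span_least[of H H] span_superset by blast

lemma span_empty: "span {} = {\<zero>\<^bsub>M\<^esub>}"
proof
  have "submodule {\<zero>\<^bsub>M\<^esub>} R M"
    by (rule submoduleI) auto
  then show "span {} \<subseteq> {\<zero>\<^bsub>M\<^esub>}"
    by (rule span_least) auto
  show "{\<zero>\<^bsub>M\<^esub>} \<subseteq> span {}"
    using submodule_zero[OF span_submodule[of "{}"]] by auto
qed

text \<open>The sums \<open>u \<oplus> v\<close> form a submodule that contains both sets.\<close>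
lemma span_Un:
  assumes "X \<subseteq> carrier M" "Y \<subseteq> carrier M" "z \<in> span (X \<union> Y)"
  obtains u v where "u \<in> span X" "v \<in> span Y" "z = u \<oplus>\<^bsub>M\<^esub> v"
proof -
  note X = submoduleD[OF span_submodule[OF assms(1)]]
  note Y = submoduleD[OF span_submodule[OF assms(2)]]
  let ?H = "{z. \<exists>u\<in>span X. \<exists>v\<in>span Y. z = u \<oplus>\<^bsub>M\<^esub> v}"
  have "submodule ?H R M"
  proof (rule submoduleI)
    show "?H \<subseteq> carrier M"
      using X(1) Y(1) by auto
    show "\<zero>\<^bsub>M\<^esub> \<in> ?H"
      using X(2) Y(2) by (auto intro!: bexI[of _ "\<zero>\<^bsub>M\<^esub>"])
  next
    fix x y assume "x \<in> ?H" "y \<in> ?H"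
    then obtain u v u' v' where *: "u \<in> span X" "v \<in> span Y" "x = u \<oplus>\<^bsub>M\<^esub> v"
      "u' \<in> span X" "v' \<in> span Y" "y = u' \<oplus>\<^bsub>M\<^esub> v'"
      by blast
    then have "x \<oplus>\<^bsub>M\<^esub> y = (u \<oplus>\<^bsub>M\<^esub> u') \<oplus>\<^bsub>M\<^esub> (v \<oplus>\<^bsub>M\<^esub> v')"
      using X(1) Y(1) by (simp add: M.a_ac subset_iff)
    then show "x \<oplus>\<^bsub>M\<^esub> y \<in> ?H"
      using * X(3) Y(3) by blast
  next
    fix a x assume a: "a \<in> carrier R" and "x \<in> ?H"
    then obtain u v where *: "u \<in> span X" "v \<in> span Y" "x = u \<oplus>\<^bsub>M\<^esub> v"
      by blast
    then have "a \<odot>\<^bsub>M\<^esub> x = a \<odot>\<^bsub>M\<^esub> u \<oplus>\<^bsub>M\<^esub> a \<odot>\<^bsub>M\<^esub> v"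
      using X(1) Y(1) a by (simp add: smult_r_distr subset_iff)
    then show "a \<odot>\<^bsub>M\<^esub> x \<in> ?H"
      using * a X(4) Y(4) by blast
  qed
  moreover have "X \<subseteq> ?H"
  proof
    fix x assume x: "x \<in> X"
    show "x \<in> ?H"
      by (rule CollectI, rule bexI[of _ x], rule bexI[of _ "\<zero>\<^bsub>M\<^esub>"])
        (use x Y(2) span_superset[of X] assms(1) in auto)
  qed
  moreover have "Y \<subseteq> ?H"
  proof
    fix y assume y: "y \<in> Y"
    show "y \<in> ?H"
      by (rule CollectI, rule bexI[of _ "\<zero>\<^bsub>M\<^esub>"], rule bexI[of _ y])
        (use y X(2) span_superset[of Y] assms(2) in auto)
  qed
  ultimately have "z \<in> ?H"
    using span_least[of ?H "X \<union> Y"] assms(3) by blast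
  then show thesis
    using that by blast
qed

lemma cyclic_submodule_eq_span:
  assumes "x \<in> carrier M"
  shows "cyclic_submodule R M x = span {x}"
proof
  note S = submoduleD[OF span_submodule[of "{x}"]]
  show "cyclic_submodule R M x \<subseteq> span {x}"
    using S(4) span_superset[of "{x}"] assms by (auto simp: cyclic_submodule_def)
  have "submodule (cyclic_submodule R M x) R M"
  proof (rule submoduleI)
    fix y z assume "y \<in> cyclic_submodule R M x" "z \<in> cyclic_submodule R M x"
    then obtain a b where "a \<in> carrier R" "b \<in> carrier R" "y = a \<odot>\<^bsub>M\<^esub> x" "z = b \<odot>\<^bsub>M\<^esub> x"
      by (auto simp: cyclic_submodule_def)
    then show "y \<oplus>\<^bsub>M\<^esub> z \<in> cyclic_submodule R M x"
      unfolding cyclic_submodule_def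
      by (auto intro!: exI[of _ "a \<oplus>\<^bsub>R\<^esub> b"] simp: smult_l_distr assms)
  next
    fix a y assume "a \<in> carrier R" "y \<in> cyclic_submodule R M x"
    then obtain b where "a \<in> carrier R" "b \<in> carrier R" "y = b \<odot>\<^bsub>M\<^esub> x"
      by (auto simp: cyclic_submodule_def)
    then show "a \<odot>\<^bsub>M\<^esub> y \<in> cyclic_submodule R M x"
      unfolding cyclic_submodule_def
      by (auto intro!: exI[of _ "a \<otimes>\<^bsub>R\<^esub> b"] simp: smult_assoc assms)
  next
    show "\<zero>\<^bsub>M\<^esub> \<in> cyclic_submodule R M x"
      using smult_zero_left[OF assms] by (force simp: cyclic_submodule_def)
  qed (use assms in \<open>auto simp: cyclic_submodule_def\<close>)
  moreover have "x \<in> cyclic_submodule R M x"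
    using smult_one[OF assms] by (force simp: cyclic_submodule_def)
  ultimately show "span {x} \<subseteq> cyclic_submodule R M x"
    by (intro span_least) auto
qed

lemma span_insert:
  assumes "x \<in> carrier M" "X \<subseteq> carrier M" "y \<in> span (insert x X)"
  obtains a w where "a \<in> carrier R" "w \<in> span X" "y = a \<odot>\<^bsub>M\<^esub> x \<oplus>\<^bsub>M\<^esub> w"
proof -
  obtain u w where "u \<in> span {x}" "w \<in> span X" "y = u \<oplus>\<^bsub>M\<^esub> w"
    using span_Un[of "{x}" X y] assms by auto
  moreover from this obtain a where "a \<in> carrier R" "u = a \<odot>\<^bsub>M\<^esub> x"
    using cyclic_submodule_eq_span[OF assms(1)] by (auto simp: cyclic_submodule_def)
  ultimately show thesis
    using that by blast
qed

text \<open>Spans are finitary, which is what makes independence pass to unions of chains and lets finitely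
  many generators be reached by finitely many basis elements.\<close>
lemma span_finite_subset:
  assumes "X \<subseteq> carrier M" "y \<in> span X"
  obtains F where "finite F" "F \<subseteq> X" "y \<in> span F"
proof -
  let ?H = "{y. \<exists>F. finite F \<and> F \<subseteq> X \<and> y \<in> span F}"
  have sub: "F \<subseteq> X \<Longrightarrow> submodule (span F) R M" for F
    using span_submodule assms(1) by blast
  have "submodule ?H R M"
  proof (rule submoduleI)
    show "?H \<subseteq> carrier M"
      using submodule_carrier[OF sub] by blast
    show "\<zero>\<^bsub>M\<^esub> \<in> ?H"
      using submodule_zero[OF sub[of "{}"]] by blast
  next
    fix x y assume "x \<in> ?H" "y \<in> ?H"
    then obtain F G where *: "finite F" "F \<subseteq> X" "x \<in> span F" "finite G" "G \<subseteq> X" "y \<in> span G"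
      by blast
    then have "x \<in> span (F \<union> G)" "y \<in> span (F \<union> G)"
      using span_mono[of F "F \<union> G"] span_mono[of G "F \<union> G"] by auto
    then have "x \<oplus>\<^bsub>M\<^esub> y \<in> span (F \<union> G)"
      using submodule_add[OF sub[of "F \<union> G"]] * by blast
    then show "x \<oplus>\<^bsub>M\<^esub> y \<in> ?H"
      using * by (auto intro!: exI[of _ "F \<union> G"])
  next
    fix a x assume "a \<in> carrier R" "x \<in> ?H"
    then show "a \<odot>\<^bsub>M\<^esub> x \<in> ?H"
      using submodule_smult[OF sub] by blast
  qed
  moreover have "X \<subseteq> ?H"
  proof
    fix x assume "x \<in> X"
    then show "x \<in> ?H"
      using span_superset[of "{x}"] by (auto intro!: exI[of _ "{x}"])
  qed
  ultimately have "y \<in> ?H"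
    using span_least[of ?H X] assms(2) by blast
  then show thesis
    using that by blast
qed

section \<open>Generators of simple submodules\<close>

definition simple_vectors :: "'c set" where
  "simple_vectors = {x \<in> carrier M. simple_submodule R M (cyclic_submodule R M x)}"

text \<open>Simplicity of \<open>R x\<close> becomes a statement about scalars: every nonzero multiple of \<open>x\<close> can be
  multiplied back to \<open>x\<close>.  This replaces the invertibility of nonzero scalars over a field.\<close>
lemma simple_vectors_iff:
  "x \<in> simple_vectors \<longleftrightarrow> x \<in> carrier M \<and> x \<noteq> \<zero>\<^bsub>M\<^esub> \<and>
     (\<forall>a\<in>carrier R. a \<odot>\<^bsub>M\<^esub> x \<noteq> \<zero>\<^bsub>M\<^esub> \<longrightarrow> (\<exists>b\<in>carrier R. b \<odot>\<^bsub>M\<^esub> (a \<odot>\<^bsub>M\<^esub> x) = x))"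
    (is "?L \<longleftrightarrow> ?R")
proof
  assume L: ?L
  then have x: "x \<in> carrier M" and "span {x} \<noteq> {\<zero>\<^bsub>M\<^esub>}"
    and min: "\<And>H. submodule H R M \<Longrightarrow> H \<subseteq> span {x} \<Longrightarrow> H = {\<zero>\<^bsub>M\<^esub>} \<or> H = span {x}"
    by (auto simp: simple_vectors_def simple_submodule_def cyclic_submodule_eq_span)
  then have "x \<noteq> \<zero>\<^bsub>M\<^esub>"
    using span_of_submodule[of "{\<zero>\<^bsub>M\<^esub>}"] span_submodule[of "{}"] span_empty by auto
  moreover have "\<exists>b\<in>carrier R. b \<odot>\<^bsub>M\<^esub> (a \<odot>\<^bsub>M\<^esub> x) = x"
    if a: "a \<in> carrier R" "a \<odot>\<^bsub>M\<^esub> x \<noteq> \<zero>\<^bsub>M\<^esub>" for a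
  proof -
    have "span {a \<odot>\<^bsub>M\<^esub> x} \<subseteq> span {x}"
      using submodule_smult[OF span_submodule[of "{x}"] a(1), of x] span_superset[of "{x}"] x
      by (intro span_subset_span) auto
    then have "span {a \<odot>\<^bsub>M\<^esub> x} = span {x}"
      using min[of "span {a \<odot>\<^bsub>M\<^esub> x}"] span_submodule[of "{a \<odot>\<^bsub>M\<^esub> x}"] x a
        span_superset[of "{a \<odot>\<^bsub>M\<^esub> x}"] by auto
    then have "x \<in> cyclic_submodule R M (a \<odot>\<^bsub>M\<^esub> x)"
      using span_superset[of "{x}"] x a by (auto simp: cyclic_submodule_eq_span)
    then obtain b where b: "x = b \<odot>\<^bsub>M\<^esub> (a \<odot>\<^bsub>M\<^esub> x)" "b \<in> carrier R"
      unfolding cyclic_submodule_def mem_Collect_eq by (elim exE conjE)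
    show ?thesis
      using b(1)[symmetric] b(2) by (rule bexI)
  qed
  ultimately show ?R
    using x by blast
next
  assume R: ?R
  have "H = {\<zero>\<^bsub>M\<^esub>} \<or> H = span {x}" if H: "submodule H R M" "H \<subseteq> span {x}" for H
  proof (cases "H = {\<zero>\<^bsub>M\<^esub>}")
    case False
    then obtain h where h: "h \<in> H" "h \<noteq> \<zero>\<^bsub>M\<^esub>"
      using submodule_zero[OF H(1)] by auto
    then obtain a where a: "a \<in> carrier R" "h = a \<odot>\<^bsub>M\<^esub> x"
      using H(2) R by (auto simp: cyclic_submodule_eq_span[symmetric] cyclic_submodule_def)
    then obtain b where "b \<in> carrier R" "b \<odot>\<^bsub>M\<^esub> h = x"
      using R h by auto
    then have "x \<in> H"
      using submodule_smult[OF H(1)] h by blast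
    then show ?thesis
      using span_least[OF H(1), of "{x}"] H(2) by auto
  qed simp
  moreover have "span {x} \<noteq> {\<zero>\<^bsub>M\<^esub>}"
    using R span_superset[of "{x}"] by auto
  ultimately show ?L
    using R span_submodule[of "{x}"]
    by (simp add: simple_vectors_def simple_submodule_def cyclic_submodule_eq_span)
qed

lemma simple_vectors_carrier: "simple_vectors \<subseteq> carrier M"
  by (auto simp: simple_vectors_def)

text \<open>The hypothesis on annihilators says that \<open>a x \<mapsto> a y\<close> is a well-defined homomorphism from \<open>R x\<close> onto
  \<open>R y\<close>; a nonzero homomorphic image of a simple module is simple.  It is applied to \<open>y = \<phi> x\<close>
  and to the component \<open>y\<close> of \<open>x\<close> in a direct summand.\<close>
lemma simple_vectors_image:
  assumes x: "x \<in> simple_vectors" and y: "y \<in> carrier M" "y \<noteq> \<zero>\<^bsub>M\<^esub>"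
    and ann: "\<And>a. a \<in> carrier R \<Longrightarrow> a \<odot>\<^bsub>M\<^esub> x = \<zero>\<^bsub>M\<^esub> \<Longrightarrow> a \<odot>\<^bsub>M\<^esub> y = \<zero>\<^bsub>M\<^esub>"
  shows "y \<in> simple_vectors"
  unfolding simple_vectors_iff
proof (intro conjI ballI impI)
  fix a assume a: "a \<in> carrier R" "a \<odot>\<^bsub>M\<^esub> y \<noteq> \<zero>\<^bsub>M\<^esub>"
  have xc: "x \<in> carrier M"
    using x simple_vectors_carrier by auto
  obtain b where b: "b \<in> carrier R" "b \<odot>\<^bsub>M\<^esub> (a \<odot>\<^bsub>M\<^esub> x) = x"
    using x ann[OF a(1)] a unfolding simple_vectors_iff by blast
  have eq: "(b \<otimes>\<^bsub>R\<^esub> a \<oplus>\<^bsub>R\<^esub> \<ominus>\<^bsub>R\<^esub> \<one>\<^bsub>R\<^esub>) \<odot>\<^bsub>M\<^esub> z = b \<odot>\<^bsub>M\<^esub> (a \<odot>\<^bsub>M\<^esub> z) \<ominus>\<^bsub>M\<^esub> z" if "z \<in> carrier M" for z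
    using that a b by (simp add: smult_l_distr smult_assoc smult_minus_one M.minus_eq)
  \<comment> \<open>The scalar \<open>b a - 1\<close> annihilates \<open>x\<close>, hence also \<open>y\<close>.\<close>
  have "(b \<otimes>\<^bsub>R\<^esub> a \<oplus>\<^bsub>R\<^esub> \<ominus>\<^bsub>R\<^esub> \<one>\<^bsub>R\<^esub>) \<odot>\<^bsub>M\<^esub> y = \<zero>\<^bsub>M\<^esub>"
    using a b xc eq[OF xc] by (intro ann) (auto simp: M.minus_eq M.r_neg)
  then have "b \<odot>\<^bsub>M\<^esub> (a \<odot>\<^bsub>M\<^esub> y) = y"
    using eq[OF y(1)] y(1) a b diff_add_cancel_right[of "b \<odot>\<^bsub>M\<^esub> (a \<odot>\<^bsub>M\<^esub> y)" y] by simp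
  then show "\<exists>b\<in>carrier R. b \<odot>\<^bsub>M\<^esub> (a \<odot>\<^bsub>M\<^esub> y) = y"
    using b by blast
qed (use y in auto)

text \<open>A simple submodule \<open>R x\<close> that is not contained in \<open>N\<close> meets \<open>N\<close> trivially: a nonzero multiple of \<open>x\<close>
  in \<open>N\<close> could be multiplied back to \<open>x\<close>.\<close>
lemma simple_vector_multiple_in_submodule:
  assumes "x \<in> simple_vectors" "submodule N R M" "x \<notin> N" "a \<in> carrier R" "a \<odot>\<^bsub>M\<^esub> x \<in> N"
  shows "a \<odot>\<^bsub>M\<^esub> x = \<zero>\<^bsub>M\<^esub>"
  using assms submodule_smult[OF assms(2)] unfolding simple_vectors_iff by metis

text \<open>Writing \<open>y = a x + w\<close> with \<open>w \<in> span X\<close>, the multiple \<open>a x\<close> is not zero, so some \<open>b\<close> takes it back to \<open>x\<close>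
  and \<open>x = b (y - w)\<close>.\<close>
lemma span_exchange:
  assumes x: "x \<in> simple_vectors" and X: "X \<subseteq> carrier M"
    and y: "y \<in> span (insert x X)" "y \<notin> span X"
  shows "x \<in> span (insert y X)"
proof -
  have xc: "x \<in> carrier M"
    using x simple_vectors_carrier by auto
  have yc: "y \<in> carrier M"
    using y(1) span_carrier[of "insert x X"] xc X by auto
  obtain a w where a: "a \<in> carrier R" and w: "w \<in> span X" and y_eq: "y = a \<odot>\<^bsub>M\<^esub> x \<oplus>\<^bsub>M\<^esub> w"
    using span_insert[OF xc X y(1)] .
  have wc: "w \<in> carrier M"
    using w span_carrier[OF X] by auto
  have "a \<odot>\<^bsub>M\<^esub> x \<noteq> \<zero>\<^bsub>M\<^esub>"
    using y_eq y(2) w wc by auto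
  then obtain b where b: "b \<in> carrier R" "b \<odot>\<^bsub>M\<^esub> (a \<odot>\<^bsub>M\<^esub> x) = x"
    using x a unfolding simple_vectors_iff by blast
  note S = submoduleD[OF span_submodule[of "insert y X"]]
  have "y \<in> span (insert y X)" "w \<in> span (insert y X)"
    using span_superset[of "insert y X"] span_mono[of X "insert y X"] w by auto
  then have "y \<ominus>\<^bsub>M\<^esub> w \<in> span (insert y X)"
    using S(5) X yc by blast
  then have "a \<odot>\<^bsub>M\<^esub> x \<in> span (insert y X)"
    using y_eq a xc wc by (simp add: add_diff_cancel_right)
  then show ?thesis
    using S(4)[of b "a \<odot>\<^bsub>M\<^esub> x"] b X yc by auto
qed

section \<open>Independence over a submodule\<close>

definition independent_over :: "'c set \<Rightarrow> 'c set \<Rightarrow> bool" where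
  "independent_over N A \<longleftrightarrow> (\<forall>x\<in>A. x \<notin> span (N \<union> (A - {x})))"

text \<open>Zorn's lemma gives a maximal independent \<open>B\<close>.  If some \<open>v \<in> V\<close> were outside the span of \<open>N \<union> B\<close>, then
  \<open>insert v B\<close> would still be independent: a dependence of \<open>x \<in> B\<close> on the others could be exchanged
  into one of \<open>v\<close> on \<open>N \<union> B\<close>.\<close>
lemma independent_extend:
  assumes N: "N \<subseteq> carrier M" and V: "V \<subseteq> simple_vectors"
    and A: "A \<subseteq> V" "independent_over N A"
  obtains B where "A \<subseteq> B" "B \<subseteq> V" "independent_over N B" "V \<subseteq> span (N \<union> B)"
proof -
  have Vc: "V \<subseteq> carrier M"
    using V simple_vectors_carrier by auto
  let ?\<A> = "{B. A \<subseteq> B \<and> B \<subseteq> V \<and> independent_over N B}"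
  have "\<exists>B\<in>?\<A>. \<forall>C\<in>?\<A>. B \<subseteq> C \<longrightarrow> C = B"
  proof (rule subset_Zorn_nonempty)
    show "?\<A> \<noteq> {}"
      using A by blast
  next
    fix \<C> assume ne: "\<C> \<noteq> {}" and ch: "subset.chain ?\<A> \<C>"
    have between: "A \<subseteq> C" "C \<subseteq> V" if "C \<in> \<C>" for C
      using ch that by (auto simp: subset_chain_def)
    then have sub: "\<Union>\<C> \<subseteq> V" "A \<subseteq> \<Union>\<C>"
      using ne by (blast, metis Union_upper ex_in_conv order_trans)
    have "x \<notin> span (N \<union> (\<Union>\<C> - {x}))" if x: "x \<in> \<Union>\<C>" for x
    proof
      assume asm: "x \<in> span (N \<union> (\<Union>\<C> - {x}))"
      have "N \<union> (\<Union>\<C> - {x}) \<subseteq> carrier M"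
        using N Vc sub(1) by blast
      then obtain F where F: "finite F" "F \<subseteq> N \<union> (\<Union>\<C> - {x})" "x \<in> span F"
        using span_finite_subset[OF _ asm] by metis
      \<comment> \<open>The dependence uses finitely many vectors, and these lie in a single member of the chain.\<close>
      have "finite (insert x (F - N))" "insert x (F - N) \<subseteq> \<Union>\<C>"
        using F x by auto
      then obtain C where C: "C \<in> \<C>" "insert x (F - N) \<subseteq> C"
        using finite_subset_Union_chain[OF _ _ ne ch] by metis
      then have "F \<subseteq> N \<union> (C - {x})"
        using F by auto
      then have "x \<in> span (N \<union> (C - {x}))"
        using span_mono F(3) by blast
      then show False
        using C ch by (auto simp: subset_chain_def independent_over_def)
    qed
    then show "\<Union>\<C> \<in> ?\<A>"
      using sub by (simp add: independent_over_def)
  qed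
  then obtain B where B: "A \<subseteq> B" "B \<subseteq> V" "independent_over N B"
    and max: "\<And>C. A \<subseteq> C \<Longrightarrow> C \<subseteq> V \<Longrightarrow> independent_over N C \<Longrightarrow> B \<subseteq> C \<Longrightarrow> C = B"
    by auto
  have "v \<in> span (N \<union> B)" if v: "v \<in> V" for v
  proof (rule ccontr)
    assume nv: "v \<notin> span (N \<union> B)"
    then have vB: "v \<notin> B"
      using span_superset[of "N \<union> B"] by auto
    have "independent_over N (insert v B)"
      unfolding independent_over_def
    proof
      fix x assume x: "x \<in> insert v B"
      show "x \<notin> span (N \<union> (insert v B - {x}))"
      proof (cases "x = v")
        case True
        then show ?thesis
          using nv vB by simp
      next
        case False
        then have xB: "x \<in> B"
          using x by auto
        have eq: "N \<union> (insert v B - {x}) = insert v (N \<union> (B - {x}))"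
          "insert x (N \<union> (B - {x})) = N \<union> B"
          using False xB by auto
        have Xc: "N \<union> (B - {x}) \<subseteq> carrier M" and vs: "v \<in> simple_vectors"
          using N B(2) Vc v V by auto
        have xN: "x \<notin> span (N \<union> (B - {x}))"
          using B(3) xB by (simp add: independent_over_def)
        show ?thesis
        proof
          assume "x \<in> span (N \<union> (insert v B - {x}))"
          then have "v \<in> span (insert x (N \<union> (B - {x})))"
            using span_exchange[OF vs Xc _ xN] eq(1) by simp
          then show False
            using nv eq by simp
        qed
      qed
    qed
    then show False
      using max[of "insert v B"] B v vB by auto
  qed
  then show thesis
    using that B by blast
qed

text \<open>The sum of \<open>N\<close> and \<open>span A\<close> is direct because in a combination of \<open>A\<close> that lies in \<open>N\<close>, each
  term \<open>a v\<close> lies in the span of \<open>N\<close> and the other vectors, so it is zero by simplicity.\<close>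
lemma independent_over_Int_span:
  assumes N: "submodule N R M" and A: "A \<subseteq> simple_vectors" "independent_over N A"
    and y: "y \<in> N" "y \<in> span A"
  shows "y = \<zero>\<^bsub>M\<^esub>"
proof -
  have Ac: "A \<subseteq> carrier M" and Nc: "N \<subseteq> carrier M"
    using A(1) simple_vectors_carrier submodule_carrier[OF N] by auto
  have "y = \<zero>\<^bsub>M\<^esub>" if "finite F" "F \<subseteq> A" "y \<in> span F" for F
    using that
  proof (induction F rule: finite_induct)
    case empty
    then show ?case
      using span_empty by auto
  next
    case (insert v F)
    have v: "v \<in> carrier M" "F \<subseteq> carrier M"
      using insert Ac by auto
    obtain a w where a: "a \<in> carrier R" and w: "w \<in> span F" and y_eq: "y = a \<odot>\<^bsub>M\<^esub> v \<oplus>\<^bsub>M\<^esub> w"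
      using span_insert[OF v insert.prems(2)] .
    have wc: "w \<in> carrier M"
      using w span_carrier[OF v(2)] by auto
    let ?S = "span (N \<union> (A - {v}))"
    have S: "submodule ?S R M"
      using Nc Ac by (intro span_submodule) auto
    have "y \<in> ?S" "w \<in> ?S"
      using y(1) span_superset[of "N \<union> (A - {v})"] span_mono[of F "N \<union> (A - {v})"] w insert by auto
    then have "y \<ominus>\<^bsub>M\<^esub> w \<in> ?S"
      using submodule_diff[OF S] by blast
    then have "a \<odot>\<^bsub>M\<^esub> v \<in> ?S"
      using y_eq a v wc by (simp add: add_diff_cancel_right)
    then have "a \<odot>\<^bsub>M\<^esub> v = \<zero>\<^bsub>M\<^esub>"
      using simple_vector_multiple_in_submodule[OF _ S _ a] insert.prems A
      by (auto simp: independent_over_def)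
    then have "y = w"
      using y_eq wc by simp
    then show ?case
      using insert w by auto
  qed
  then show ?thesis
    using span_finite_subset[OF Ac y(2)] by metis
qed

lemma independent_over_Un:
  assumes A: "A \<subseteq> simple_vectors" "independent_over (span B) A"
    and B: "B \<subseteq> simple_vectors" "independent_over {} B"
  shows "independent_over {} (A \<union> B)"
  unfolding independent_over_def
proof
  have Ac: "A \<subseteq> carrier M" and Bc: "B \<subseteq> carrier M"
    using A B simple_vectors_carrier by auto
  note S = span_submodule[OF Bc]
  fix x assume x: "x \<in> A \<union> B"
  show "x \<notin> span ({} \<union> (A \<union> B - {x}))"
  proof
    assume asm: "x \<in> span ({} \<union> (A \<union> B - {x}))"
    show False
    proof (cases "x \<in> A")
      case True
      have "A \<union> B - {x} \<subseteq> span B \<union> (A - {x})"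
        using span_superset[of B] by auto
      then show False
        using asm True A(2) span_mono[of "A \<union> B - {x}" "span B \<union> (A - {x})"]
        by (auto simp: independent_over_def)
    next
      case False
      then have xB: "x \<in> B" "A \<union> B - {x} = A \<union> (B - {x})"
        using x by auto
      have Bx: "B - {x} \<subseteq> carrier M"
        using Bc by auto
      have "x \<in> span (A \<union> (B - {x}))"
        using asm xB(2) by simp
      then obtain u v where u: "u \<in> span A" and v: "v \<in> span (B - {x})" and x_eq: "x = u \<oplus>\<^bsub>M\<^esub> v"
        by (rule span_Un[OF Ac Bx])
      have uc: "u \<in> carrier M" and vc: "v \<in> carrier M"
        using u v span_carrier[OF Ac] span_carrier[of "B - {x}"] Bc by auto
      have "x \<in> span B" "v \<in> span B"
        using xB span_superset[of B] span_mono[of "B - {x}" B] v by auto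
      then have "x \<ominus>\<^bsub>M\<^esub> v \<in> span B"
        using submodule_diff[OF S] by blast
      then have "u \<in> span B"
        using x_eq uc vc by (simp add: add_diff_cancel_right)
      then have "u = \<zero>\<^bsub>M\<^esub>"
        using independent_over_Int_span[OF S A] u by blast
      then have "x = v"
        using x_eq vc by simp
      then show False
        using v B(2) xB by (auto simp: independent_over_def)
    qed
  qed
qed

text \<open>The finitely many generators involve only a finite part of \<open>B\<close>.  That part spans the module, and
  independence leaves no room for further elements of \<open>B\<close>.\<close>
lemma finite_independent_span:
  assumes fg: "finitely_generated_module R M"
    and B: "B \<subseteq> carrier M" "independent_over {} B" "span B = carrier M"
  shows "finite B"
proof -
  obtain S where S: "finite S" "S \<subseteq> carrier M" "span S = carrier M"
    using fg by (auto simp: finitely_generated_module_def)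
  have "\<forall>s\<in>S. \<exists>F. finite F \<and> F \<subseteq> B \<and> s \<in> span F"
    using span_finite_subset[OF B(1)] S(2) B(3) by (metis subsetD)
  then obtain F where F: "\<And>s. s \<in> S \<Longrightarrow> finite (F s) \<and> F s \<subseteq> B \<and> s \<in> span (F s)"
    by metis
  let ?C = "\<Union>s\<in>S. F s"
  have C: "?C \<subseteq> B"
    using F by auto
  have "S \<subseteq> span ?C"
    using F span_mono[of _ ?C] by blast
  then have full: "carrier M \<subseteq> span ?C"
    using span_subset_span[of ?C S] S(3) C B(1) by auto
  have "B \<subseteq> ?C"
  proof
    fix x assume x: "x \<in> B"
    show "x \<in> ?C"
    proof (rule ccontr)
      assume "x \<notin> ?C"
      then have "?C \<subseteq> {} \<union> (B - {x})"
        using C by auto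
      then have "x \<in> span ({} \<union> (B - {x}))"
        using span_mono full x B(1) by blast
      then show False
        using B(2) x by (auto simp: independent_over_def)
    qed
  qed
  then show ?thesis
    using finite_subset[of B ?C] F S(1) by auto
qed

section \<open>Semisimple modules\<close>

text \<open>Every nonzero element of a simple summand \<open>S\<close> generates \<open>S\<close> and is therefore a simple vector.\<close>
lemma semisimple_span_simple_vectors:
  assumes "semisimple_module R M"
  shows "span simple_vectors = carrier M"
proof
  show "span simple_vectors \<subseteq> carrier M"
    using span_carrier[OF simple_vectors_carrier] .
  obtain \<S> where S: "\<And>S. S \<in> \<S> \<Longrightarrow> simple_submodule R M S" and sp: "span (\<Union>\<S>) = carrier M"
    using assms by (auto simp: semisimple_module_def internal_direct_sum_def)
  have "s \<in> span simple_vectors" if s: "s \<in> S" "S \<in> \<S>" for s S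
  proof (cases "s = \<zero>\<^bsub>M\<^esub>")
    case True
    then show ?thesis
      using submodule_zero[OF span_submodule[OF simple_vectors_carrier]] by simp
  next
    case False
    have sub: "submodule S R M"
      using S s by (simp add: simple_submodule_def)
    then have sc: "s \<in> carrier M"
      using submodule_carrier s by auto
    have "span {s} \<subseteq> S" "s \<in> span {s}" "submodule (span {s}) R M"
      using span_least[OF sub, of "{s}"] s span_superset[of "{s}"] span_submodule[of "{s}"] sc by auto
    then have "span {s} = S"
      using S[OF s(2)] False by (auto simp: simple_submodule_def)
    then have "s \<in> simple_vectors"
      using S[OF s(2)] sc by (simp add: simple_vectors_def cyclic_submodule_eq_span)
    then show ?thesis
      using span_superset by auto
  qed
  then show "carrier M \<subseteq> span simple_vectors"
    using span_subset_span[OF simple_vectors_carrier, of "\<Union>\<S>"] sp by auto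
qed

text \<open>A basis \<open>A\<close> of the module over \<open>N\<close> spans a complement of \<open>N\<close>.  The projection onto \<open>N\<close> along this
  complement maps simple vectors to simple vectors or zero, so the images of all simple vectors
  span \<open>N\<close>.\<close>
lemma submodule_span_simple_vectors:
  assumes ss: "span simple_vectors = carrier M" and N: "submodule N R M"
  shows "span (simple_vectors \<inter> N) = N"
proof
  let ?W = "simple_vectors \<inter> N"
  have Nc: "N \<subseteq> carrier M" and Wc: "?W \<subseteq> carrier M"
    using submodule_carrier[OF N] by auto
  show WN: "span ?W \<subseteq> N"
    by (rule span_least[OF N]) auto
  obtain A where A: "A \<subseteq> simple_vectors" "independent_over N A" "simple_vectors \<subseteq> span (N \<union> A)"
    using independent_extend[OF Nc subset_refl, of "{}"] by (auto simp: independent_over_def)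
  have Ac: "A \<subseteq> carrier M"
    using A simple_vectors_carrier by auto
  note C = submoduleD[OF span_submodule[OF Ac]]
  have WAc: "?W \<union> A \<subseteq> carrier M"
    using Wc Ac by auto
  note WA = submoduleD[OF span_submodule[OF WAc]]
  have NA_zero: "y = \<zero>\<^bsub>M\<^esub>" if "y \<in> N" "y \<in> span A" for y
    using independent_over_Int_span[OF N A(1,2)] that .
  have "v \<in> span (?W \<union> A)" if v: "v \<in> simple_vectors" for v
  proof -
    obtain n c where n: "n \<in> N" and c: "c \<in> span A" and v_eq: "v = n \<oplus>\<^bsub>M\<^esub> c"
      using span_Un[OF Nc Ac, of v] A(3) v span_of_submodule[OF N] by auto
    have nc: "n \<in> carrier M" "c \<in> carrier M"
      using n c Nc C(1) by auto
    have "n \<in> span (?W \<union> A)"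
    proof (cases "n = \<zero>\<^bsub>M\<^esub>")
      case True
      then show ?thesis
        using WA(2) by simp
    next
      case False
      have "n \<in> simple_vectors"
      proof (rule simple_vectors_image[OF v nc(1) False])
        fix a assume a: "a \<in> carrier R" "a \<odot>\<^bsub>M\<^esub> v = \<zero>\<^bsub>M\<^esub>"
        then have "a \<odot>\<^bsub>M\<^esub> n \<oplus>\<^bsub>M\<^esub> a \<odot>\<^bsub>M\<^esub> c = \<zero>\<^bsub>M\<^esub>"
          using v_eq smult_r_distr nc by simp
        then have "a \<odot>\<^bsub>M\<^esub> n = \<zero>\<^bsub>M\<^esub> \<ominus>\<^bsub>M\<^esub> a \<odot>\<^bsub>M\<^esub> c"
          using add_diff_cancel_right[of "a \<odot>\<^bsub>M\<^esub> n" "a \<odot>\<^bsub>M\<^esub> c"] a nc by simp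
        then have "a \<odot>\<^bsub>M\<^esub> n \<in> span A"
          using C(2,4,5) a c by simp
        then show "a \<odot>\<^bsub>M\<^esub> n = \<zero>\<^bsub>M\<^esub>"
          using NA_zero submodule_smult[OF N] a n by blast
      qed
      then show ?thesis
        using n span_superset[of "?W \<union> A"] by auto
    qed
    moreover have "c \<in> span (?W \<union> A)"
      using c span_mono[of A "?W \<union> A"] by auto
    ultimately show ?thesis
      using WA(3) v_eq by simp
  qed
  then have full: "carrier M \<subseteq> span (?W \<union> A)"
    using span_subset_span[OF WAc, of simple_vectors] ss by auto
  show "N \<subseteq> span ?W"
  proof
    fix x assume x: "x \<in> N"
    then have "x \<in> span (?W \<union> A)"
      using full Nc by auto
    then obtain u c where u: "u \<in> span ?W" and c: "c \<in> span A" and x_eq: "x = u \<oplus>\<^bsub>M\<^esub> c"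
      by (rule span_Un[OF Wc Ac])
    have uc: "u \<in> carrier M" "c \<in> carrier M"
      using u c WN Nc C(1) by auto
    have "x \<ominus>\<^bsub>M\<^esub> u \<in> N"
      using submodule_diff[OF N] x u WN by blast
    then have "c \<in> N"
      using x_eq uc add_diff_cancel_right[of c u] by (simp add: M.a_comm)
    then have "c = \<zero>\<^bsub>M\<^esub>"
      using NA_zero c by blast
    then show "x \<in> span ?W"
      using x_eq uc u by simp
  qed
qed

end

section \<open>Kernels of the powers of an endomorphism\<close>

locale left_module_endomorphism = left_module R M for R (structure) and M (structure) +
  fixes \<phi>
  assumes endo: "module_endomorphism R M \<phi>"
begin

lemma endo_closed: "x \<in> carrier M \<Longrightarrow> \<phi> x \<in> carrier M"
  using endo by (auto simp: module_endomorphism_def hom_def)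

lemma endo_add:
  "x \<in> carrier M \<Longrightarrow> y \<in> carrier M \<Longrightarrow> \<phi> (x \<oplus>\<^bsub>M\<^esub> y) = \<phi> x \<oplus>\<^bsub>M\<^esub> \<phi> y"
  using endo by (auto simp: module_endomorphism_def hom_def)

lemma endo_smult:
  "a \<in> carrier R \<Longrightarrow> x \<in> carrier M \<Longrightarrow> \<phi> (a \<odot>\<^bsub>M\<^esub> x) = a \<odot>\<^bsub>M\<^esub> \<phi> x"
  using endo by (auto simp: module_endomorphism_def)

lemma endo_zero: "\<phi> \<zero>\<^bsub>M\<^esub> = \<zero>\<^bsub>M\<^esub>"
  using endo_smult[of "\<zero>\<^bsub>R\<^esub>" "\<zero>\<^bsub>M\<^esub>"] endo_closed by simp

lemma endo_diff:
  assumes "x \<in> carrier M" "y \<in> carrier M"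
  shows "\<phi> (x \<ominus>\<^bsub>M\<^esub> y) = \<phi> x \<ominus>\<^bsub>M\<^esub> \<phi> y"
  using endo_add[of "x \<ominus>\<^bsub>M\<^esub> y" y] add_diff_cancel_right[of "\<phi> (x \<ominus>\<^bsub>M\<^esub> y)" "\<phi> y"]
    diff_add_cancel_right[of x y] assms endo_closed by simp

definition kernel_power :: "nat \<Rightarrow> 'c set" where
  "kernel_power n = {x \<in> carrier M. (\<phi> ^^ n) x = \<zero>\<^bsub>M\<^esub>}"

lemma kernel_power_0: "kernel_power 0 = {\<zero>\<^bsub>M\<^esub>}"
  by (auto simp: kernel_power_def)

lemma kernel_power_Suc: "x \<in> kernel_power (Suc n) \<longleftrightarrow> x \<in> carrier M \<and> \<phi> x \<in> kernel_power n"
  using endo_closed by (auto simp: kernel_power_def funpow_swap1)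

lemma kernel_power_submodule: "submodule (kernel_power n) R M"
proof (induction n)
  case 0
  show ?case
    unfolding kernel_power_0 by (rule submoduleI) auto
next
  case (Suc n)
  note K = submoduleD[OF Suc]
  show ?case
    by (rule submoduleI)
      (auto simp: kernel_power_Suc endo_add endo_smult endo_zero intro: K(2,3,4))
qed

lemma kernel_power_mono: "m \<le> n \<Longrightarrow> kernel_power m \<subseteq> kernel_power n"
proof (induction rule: dec_induct)
  case (step n)
  have "(\<phi> ^^ Suc n) x = \<zero>\<^bsub>M\<^esub>" if "(\<phi> ^^ n) x = \<zero>\<^bsub>M\<^esub>" for x
    using that endo_zero by simp
  then show ?case
    using step by (auto simp: kernel_power_def)
qed simp

lemma simple_vectors_endo:
  assumes "x \<in> simple_vectors" "\<phi> x \<noteq> \<zero>\<^bsub>M\<^esub>"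
  shows "\<phi> x \<in> simple_vectors"
proof (rule simple_vectors_image[OF assms(1) _ assms(2)])
  have xc: "x \<in> carrier M"
    using assms simple_vectors_carrier by auto
  then show "\<phi> x \<in> carrier M"
    by (rule endo_closed)
  fix a assume "a \<in> carrier R" "a \<odot>\<^bsub>M\<^esub> x = \<zero>\<^bsub>M\<^esub>"
  then show "a \<odot>\<^bsub>M\<^esub> \<phi> x = \<zero>\<^bsub>M\<^esub>"
    using endo_smult[of a x] xc endo_zero by simp
qed

text \<open>The difference lies in the kernel of \<open>\<phi>\<close>, hence in the kernel of every positive power.\<close>
lemma eq_endo_diff_kernel:
  assumes "x \<in> carrier M" "y \<in> carrier M" "\<phi> x = \<phi> y"
  shows "x \<ominus>\<^bsub>M\<^esub> y \<in> kernel_power (Suc n)"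
proof -
  have "\<phi> (x \<ominus>\<^bsub>M\<^esub> y) = \<zero>\<^bsub>M\<^esub>"
    using endo_diff[OF assms(1,2)] assms endo_closed by (simp add: M.minus_eq M.r_neg)
  then show ?thesis
    using assms submodule_zero[OF kernel_power_submodule] by (simp add: kernel_power_Suc)
qed

lemma span_image_endo:
  assumes "B \<subseteq> carrier M"
  shows "span (\<phi> ` B) \<subseteq> \<phi> ` span B"
proof (rule span_least)
  note S = submoduleD[OF span_submodule[OF assms]]
  show "submodule (\<phi> ` span B) R M"
  proof (rule submoduleI)
    show "\<phi> ` span B \<subseteq> carrier M"
      using S(1) endo_closed by auto
    show "\<zero>\<^bsub>M\<^esub> \<in> \<phi> ` span B"
      using S(2) endo_zero by (metis imageI)
  next
    fix x y assume "x \<in> \<phi> ` span B" "y \<in> \<phi> ` span B"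
    then obtain u v where "u \<in> span B" "v \<in> span B" "x = \<phi> u" "y = \<phi> v"
      by blast
    then show "x \<oplus>\<^bsub>M\<^esub> y \<in> \<phi> ` span B"
      using S(1,3) endo_add[of u v] by (metis imageI subsetD)
  next
    fix a x assume a: "a \<in> carrier R" and "x \<in> \<phi> ` span B"
    then obtain u where "u \<in> span B" "x = \<phi> u"
      by blast
    then show "a \<odot>\<^bsub>M\<^esub> x \<in> \<phi> ` span B"
      using S(1,4) endo_smult[OF a, of u] a by (metis imageI subsetD)
  qed
  show "\<phi> ` B \<subseteq> \<phi> ` span B"
    using span_superset by auto
qed

text \<open>Both claims rest on the same observation: \<open>\<phi> y\<close> lies in the kernel of the \<open>n\<close>-th power if and only if
  \<open>y\<close> lies in the kernel of the next power.  So if \<open>\<phi> x\<close> depends on the other \<open>\<phi> z\<close> modulo the smaller kernel,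
  or equals one of them, then \<open>x\<close> depends on the other elements of \<open>A\<close> modulo the larger one.\<close>
lemma independent_over_kernel_image:
  assumes A: "A \<subseteq> kernel_power (Suc (Suc n))" "independent_over (kernel_power (Suc n)) A"
  shows "inj_on \<phi> A" and "independent_over (kernel_power n) (\<phi> ` A)"
proof -
  let ?K = "kernel_power (Suc n)"
  have Ac: "A \<subseteq> carrier M"
    using A(1) by (auto simp: kernel_power_def)
  have K: "submodule (kernel_power m) R M" "kernel_power m \<subseteq> carrier M" for m
    using kernel_power_submodule submodule_carrier by auto
  have notin: False if x: "x \<in> A" and z: "z \<in> span (A - {x})" and xz: "x \<ominus>\<^bsub>M\<^esub> z \<in> ?K" for x z
  proof -
    let ?S = "span (?K \<union> (A - {x}))"
    have S: "submodule ?S R M"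
      using K Ac by (intro span_submodule) auto
    have zS: "z \<in> ?S" and "x \<ominus>\<^bsub>M\<^esub> z \<in> ?S"
      using z xz span_mono[of "A - {x}" "?K \<union> (A - {x})"] span_superset[of "?K \<union> (A - {x})"] by auto
    then have "(x \<ominus>\<^bsub>M\<^esub> z) \<oplus>\<^bsub>M\<^esub> z \<in> ?S"
      using submodule_add[OF S] by blast
    moreover have "z \<in> carrier M"
      using zS submodule_carrier[OF S] by auto
    ultimately show False
      using diff_add_cancel_right[of x z] x Ac A(2) by (auto simp: independent_over_def)
  qed
  show inj: "inj_on \<phi> A"
  proof (rule inj_onI, rule ccontr)
    fix x y assume "x \<in> A" "y \<in> A" "\<phi> x = \<phi> y" "x \<noteq> y"
    then show False
      using notin[of x y] eq_endo_diff_kernel[of x y] Ac span_superset[of "A - {x}"] by auto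
  qed
  show "independent_over (kernel_power n) (\<phi> ` A)"
    unfolding independent_over_def
  proof (intro ballI notI)
    fix y assume "y \<in> \<phi> ` A" and asm: "y \<in> span (kernel_power n \<union> (\<phi> ` A - {y}))"
    then obtain x where x: "x \<in> A" "y = \<phi> x"
      by blast
    have xc: "x \<in> carrier M"
      using x Ac by auto
    have eq: "\<phi> ` A - {y} = \<phi> ` (A - {x})"
      using inj x by (auto simp: inj_on_def)
    have sub: "A - {x} \<subseteq> carrier M" "\<phi> ` (A - {x}) \<subseteq> carrier M"
      using Ac endo_closed by auto
    obtain u v where u: "u \<in> kernel_power n" and "v \<in> span (\<phi> ` (A - {x}))" and y_eq: "y = u \<oplus>\<^bsub>M\<^esub> v"
      using span_Un[OF K(2) sub(2), of y n thesis] asm eq span_of_submodule[OF K(1)[of n]] by metis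
    then obtain z where z: "z \<in> span (A - {x})" "v = \<phi> z"
      using span_image_endo[OF sub(1)] by auto
    have zc: "z \<in> carrier M"
      using z span_carrier[OF sub(1)] by auto
    have "\<phi> (x \<ominus>\<^bsub>M\<^esub> z) = u"
      using endo_diff[OF xc zc] y_eq x z u K(2) add_diff_cancel_right[of u v] zc endo_closed by auto
    then have "x \<ominus>\<^bsub>M\<^esub> z \<in> ?K"
      using u xc zc by (simp add: kernel_power_Suc)
    then show False
      using notin[OF x(1) z(1)] by blast
  qed
qed

section \<open>Bases mapped into themselves and zero\<close>

text \<open>A union of chains with the indexing forgotten: \<open>\<phi>\<close> gives each vector at most one successor and
  at most one predecessor in \<open>B\<close>.  Keeping a plain set makes unions and Zorn's lemma easy to use.\<close>
definition chain_closed :: "'c set \<Rightarrow> bool" where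
  "chain_closed B \<longleftrightarrow> \<phi> ` B \<subseteq> insert \<zero>\<^bsub>M\<^esub> B \<and> inj_on \<phi> {x \<in> B. \<phi> x \<noteq> \<zero>\<^bsub>M\<^esub>}"

text \<open>The prescribed part \<open>A\<close> is what carries the induction: after \<open>A\<close> has been extended to a basis \<open>A'\<close> of
  the larger kernel over the smaller one, the induction hypothesis is used for the image \<open>\<phi> ` A'\<close>, so that
  the basis of the smaller kernel contains the successors of all vectors in \<open>A'\<close>.\<close>
lemma chain_closed_basis_of_kernel:
  assumes ss: "span simple_vectors = carrier M"
    and A: "A \<subseteq> simple_vectors \<inter> kernel_power (Suc n)" "independent_over (kernel_power n) A"
  shows "\<exists>B. A \<subseteq> B \<and> B \<subseteq> simple_vectors \<inter> kernel_power (Suc n) \<and> independent_over {} B \<and>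
    span B = kernel_power (Suc n) \<and> chain_closed B"
  using A
proof (induction n arbitrary: A)
  case 0
  have K: "kernel_power 0 \<subseteq> carrier M"
    by (auto simp: kernel_power_def)
  obtain B where B: "A \<subseteq> B" "B \<subseteq> simple_vectors \<inter> kernel_power (Suc 0)"
    "independent_over (kernel_power 0) B"
    "simple_vectors \<inter> kernel_power (Suc 0) \<subseteq> span (kernel_power 0 \<union> B)"
    using independent_extend[OF K Int_lower1 0] .
  have Bc: "B \<subseteq> carrier M"
    using B simple_vectors_carrier by auto
  have "kernel_power 0 \<union> B \<subseteq> span B"
    using submodule_zero[OF span_submodule[OF Bc]] span_superset[of B] by (simp add: kernel_power_0)
  then have "simple_vectors \<inter> kernel_power (Suc 0) \<subseteq> span B"
    using span_subset_span[OF Bc] B(4) by blast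
  then have "kernel_power (Suc 0) \<subseteq> span B"
    using span_subset_span[OF Bc] submodule_span_simple_vectors[OF ss kernel_power_submodule] by metis
  moreover have "span B \<subseteq> kernel_power (Suc 0)"
    using span_least[OF kernel_power_submodule] B(2) by auto
  moreover have "independent_over {} B"
    using B(3) span_mono[of "{} \<union> _" "kernel_power 0 \<union> _"] unfolding independent_over_def by blast
  moreover have "chain_closed B"
    using B(2) by (auto simp: chain_closed_def kernel_power_def inj_on_def)
  ultimately show ?case
    using B by blast
next
  case (Suc n)
  let ?K = "kernel_power (Suc n)" and ?L = "kernel_power (Suc (Suc n))"
  have Kc: "?K \<subseteq> carrier M"
    by (auto simp: kernel_power_def)
  obtain A' where A': "A \<subseteq> A'" "A' \<subseteq> simple_vectors \<inter> ?L" "independent_over ?K A'"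
    "simple_vectors \<inter> ?L \<subseteq> span (?K \<union> A')"
    using independent_extend[OF Kc Int_lower1 Suc.prems] .
  have notK: "x \<notin> ?K" if "x \<in> A'" for x
    using A'(3) span_superset[of "?K \<union> (A' - {x})"] that by (auto simp: independent_over_def)
  have nz: "\<phi> x \<noteq> \<zero>\<^bsub>M\<^esub>" if "x \<in> A'" for x
    using notK[OF that] A'(2) that kernel_power_mono[of "Suc 0" "Suc n"]
    by (auto simp: kernel_power_def)
  have img: "inj_on \<phi> A'" "independent_over (kernel_power n) (\<phi> ` A')"
    using independent_over_kernel_image[OF _ A'(3)] A'(2) by auto
  have "\<phi> ` A' \<subseteq> simple_vectors \<inter> ?K"
    using A'(2) nz simple_vectors_endo by (auto simp: kernel_power_Suc)
  then obtain B where B: "\<phi> ` A' \<subseteq> B" "B \<subseteq> simple_vectors \<inter> ?K" "independent_over {} B"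
    "span B = ?K" "chain_closed B"
    using Suc.IH[OF _ img(2)] by blast
  let ?C = "A' \<union> B"
  have KL: "?K \<subseteq> ?L"
    by (rule kernel_power_mono) simp
  have C: "?C \<subseteq> simple_vectors \<inter> ?L"
    using A'(2) B(2) KL by auto
  then have Cc: "?C \<subseteq> carrier M"
    using simple_vectors_carrier by auto
  have "?K \<union> A' \<subseteq> span ?C"
    using B(4) span_mono[of B ?C] span_superset[of ?C] by auto
  then have "simple_vectors \<inter> ?L \<subseteq> span ?C"
    using span_subset_span[OF Cc] A'(4) by blast
  then have "?L \<subseteq> span ?C"
    using span_subset_span[OF Cc] submodule_span_simple_vectors[OF ss kernel_power_submodule] by metis
  moreover have "span ?C \<subseteq> ?L"
    using span_least[OF kernel_power_submodule] C by auto
  moreover have "independent_over {} ?C"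
    using independent_over_Un[of A' B] A' B by auto
  moreover have "chain_closed ?C"
  proof -
    \<comment> \<open>The new vectors \<open>A'\<close> lie outside the smaller kernel, which contains \<open>B\<close> and the kernel of \<open>\<phi>\<close>.\<close>
    have mixed: "\<phi> x \<noteq> \<phi> y" if x: "x \<in> A'" and y: "y \<in> B" for x y
    proof
      assume eq: "\<phi> x = \<phi> y"
      have xy: "x \<in> carrier M" "y \<in> carrier M" "y \<in> ?K"
        using x y B(2) Cc by auto
      then have "(x \<ominus>\<^bsub>M\<^esub> y) \<oplus>\<^bsub>M\<^esub> y \<in> ?K"
        using submodule_add[OF kernel_power_submodule] eq_endo_diff_kernel[OF _ _ eq] by blast
      then show False
        using notK[OF x] diff_add_cancel_right xy by simp
    qed
    have "inj_on \<phi> {x \<in> ?C. \<phi> x \<noteq> \<zero>\<^bsub>M\<^esub>}"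
    proof (rule inj_onI)
      fix x y
      assume x: "x \<in> {x \<in> ?C. \<phi> x \<noteq> \<zero>\<^bsub>M\<^esub>}" and y: "y \<in> {x \<in> ?C. \<phi> x \<noteq> \<zero>\<^bsub>M\<^esub>}"
        and eq: "\<phi> x = \<phi> y"
      then have "x \<in> A' \<and> y \<in> A' \<or> x \<in> B \<and> y \<in> B"
        using mixed[of x y] mixed[of y x] by auto
      then show "x = y"
      proof
        assume "x \<in> A' \<and> y \<in> A'"
        then show ?thesis
          using inj_onD[OF img(1) eq] by simp
      next
        assume "x \<in> B \<and> y \<in> B"
        moreover have "inj_on \<phi> {x \<in> B. \<phi> x \<noteq> \<zero>\<^bsub>M\<^esub>}"
          using B(5) by (simp add: chain_closed_def)
        ultimately show ?thesis
          using inj_onD[of \<phi> _ x y] eq x y by simp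
      qed
    qed
    then show ?thesis
      using B(1,5) by (auto simp: chain_closed_def)
  qed
  ultimately show ?case
    using A'(1) C by (intro exI[of _ ?C]) auto
qed

section \<open>Splitting a basis into chains\<close>

definition chain_tops :: "'c set \<Rightarrow> 'c set" where
  "chain_tops B = B - \<phi> ` B"

definition chain_length :: "'c \<Rightarrow> nat" where
  "chain_length t = (LEAST n. (\<phi> ^^ n) t = \<zero>\<^bsub>M\<^esub>)"

lemma chain_closed_funpow:
  assumes "chain_closed B" "b \<in> B"
  shows "(\<phi> ^^ m) b \<in> insert \<zero>\<^bsub>M\<^esub> B"
  by (induction m) (use assms endo_zero in \<open>auto simp: chain_closed_def\<close>)

text \<open>In \<open>B\<close> every nonzero vector has at most one predecessor under \<open>\<phi>\<close>, so going back from a common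
  nonzero element of two chains reaches both tops after equally many steps; a top has no predecessor.\<close>
lemma chain_inj:
  assumes B: "chain_closed B" "\<zero>\<^bsub>M\<^esub> \<notin> B"
    and st: "s \<in> chain_tops B" "t \<in> chain_tops B"
    and eq: "(\<phi> ^^ i) s = (\<phi> ^^ j) t" "(\<phi> ^^ i) s \<noteq> \<zero>\<^bsub>M\<^esub>"
  shows "i = j \<and> s = t"
proof -
  have inB: "(\<phi> ^^ m) u \<in> insert \<zero>\<^bsub>M\<^esub> B" if "u \<in> chain_tops B" for u m
    using chain_closed_funpow[OF B(1)] that by (auto simp: chain_tops_def)
  have step: "(\<phi> ^^ Suc m) u \<in> insert \<zero>\<^bsub>M\<^esub> (\<phi> ` B)" if "u \<in> chain_tops B" for u m
    using inB[OF that, of m] endo_zero by auto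
  show ?thesis
    using eq
  proof (induction i arbitrary: j)
    case 0
    then have "j = 0"
      using step[OF st(2), of "j - 1"] st B(2) by (cases j) (auto simp: chain_tops_def)
    then show ?case
      using 0 by simp
  next
    case (Suc i)
    obtain j' where j: "j = Suc j'"
    proof (cases j)
      case 0
      then show ?thesis
        using step[OF st(1), of i] Suc.prems st by (auto simp: chain_tops_def)
    qed
    have nz: "(\<phi> ^^ i) s \<noteq> \<zero>\<^bsub>M\<^esub>" "(\<phi> ^^ j') t \<noteq> \<zero>\<^bsub>M\<^esub>"
      using Suc.prems j endo_zero by auto
    then have "(\<phi> ^^ i) s = (\<phi> ^^ j') t"
      using inj_onD[of \<phi> "{x \<in> B. \<phi> x \<noteq> \<zero>\<^bsub>M\<^esub>}" "(\<phi> ^^ i) s" "(\<phi> ^^ j') t"] B(1) Suc.prems j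
        inB[OF st(1), of i] inB[OF st(2), of j'] by (auto simp: chain_closed_def)
    then show ?case
      using Suc.IH[of j'] nz j by simp
  qed
qed

text \<open>Choosing predecessors in \<open>B\<close> repeatedly either ends in a top or would go on for \<open>n\<close> steps; the latter is
  impossible, as the \<open>n\<close>-th power of \<open>\<phi>\<close> vanishes on \<open>B\<close> and \<open>b\<close> is not zero.\<close>
lemma chain_surj:
  assumes B: "b \<in> B" "\<zero>\<^bsub>M\<^esub> \<notin> B" and nil: "\<And>x. x \<in> B \<Longrightarrow> (\<phi> ^^ n) x = \<zero>\<^bsub>M\<^esub>"
  obtains t i where "t \<in> chain_tops B" "b = (\<phi> ^^ i) t"
proof -
  have "(\<exists>t\<in>chain_tops B. \<exists>i. b = (\<phi> ^^ i) t) \<or> (\<exists>c\<in>B. b = (\<phi> ^^ m) c)" for m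
  proof (induction m)
    case 0
    then show ?case
      using B(1) by auto
  next
    case (Suc m)
    then show ?case
    proof
      assume "\<exists>c\<in>B. b = (\<phi> ^^ m) c"
      then obtain c where c: "c \<in> B" "b = (\<phi> ^^ m) c"
        by blast
      show ?case
      proof (cases "c \<in> chain_tops B")
        case True
        then show ?thesis
          using c by blast
      next
        case False
        then obtain d where "d \<in> B" "c = \<phi> d"
          using c by (auto simp: chain_tops_def)
        then show ?thesis
          using c by (auto simp: funpow_swap1)
      qed
    qed blast
  qed
  from this[of n] show thesis
    using that nil B by metis
qed

lemma funpow_zero_mono:
  assumes "(\<phi> ^^ m) x = \<zero>\<^bsub>M\<^esub>" "m \<le> n"
  shows "(\<phi> ^^ n) x = \<zero>\<^bsub>M\<^esub>"
  using assms(2) by (induction rule: dec_induct) (use assms(1) endo_zero in auto)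

lemma chain_length_iff:
  assumes "(\<phi> ^^ n) t = \<zero>\<^bsub>M\<^esub>"
  shows "(\<phi> ^^ i) t = \<zero>\<^bsub>M\<^esub> \<longleftrightarrow> chain_length t \<le> i"
  unfolding chain_length_def
  using LeastI[of "\<lambda>n. (\<phi> ^^ n) t = \<zero>\<^bsub>M\<^esub>", OF assms] Least_le[of "\<lambda>n. (\<phi> ^^ n) t = \<zero>\<^bsub>M\<^esub>" i]
    funpow_zero_mono by blast

text \<open>Counting \<open>i\<close> from the bottom of a chain is what makes \<open>\<phi>\<close> lower the index by one: index
  \<open>chain_length t\<close> belongs to the top \<open>t\<close> and index \<open>1\<close> to the last nonzero iterate.\<close>
lemma chains_bij_betw:
  assumes B: "chain_closed B" "\<zero>\<^bsub>M\<^esub> \<notin> B" and nil: "\<And>x. x \<in> B \<Longrightarrow> (\<phi> ^^ n) x = \<zero>\<^bsub>M\<^esub>"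
    and h: "bij_betw h T (chain_tops B)"
  shows "bij_betw (\<lambda>(t, i). (\<phi> ^^ (chain_length (h t) - i)) (h t))
    (SIGMA t:T. {1..chain_length (h t)}) B"
proof -
  let ?x = "\<lambda>(t, i). (\<phi> ^^ (chain_length (h t) - i)) (h t)"
  let ?I = "SIGMA t:T. {1..chain_length (h t)}"
  have hT: "h t \<in> chain_tops B" if "t \<in> T" for t
    using h that by (auto simp: bij_betw_def)
  have len: "(\<phi> ^^ i) t = \<zero>\<^bsub>M\<^esub> \<longleftrightarrow> chain_length t \<le> i" if "t \<in> chain_tops B" for t i
    using chain_length_iff[of n t i] nil that by (auto simp: chain_tops_def)
  have nz: "?x p \<noteq> \<zero>\<^bsub>M\<^esub>" if "p \<in> ?I" for p
    using that len[OF hT] by auto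
  have "inj_on ?x ?I"
  proof (rule inj_onI)
    fix p q assume p: "p \<in> ?I" and q: "q \<in> ?I" and eq: "?x p = ?x q"
    obtain t i s j where pq: "p = (t, i)" "q = (s, j)" "t \<in> T" "s \<in> T"
      using p q by auto
    have "chain_length (h t) - i = chain_length (h s) - j \<and> h t = h s"
      using chain_inj[OF B hT hT, of t s] pq eq nz[OF p] by auto
    moreover from this have "t = s"
      using h pq by (auto simp: bij_betw_def inj_on_def)
    ultimately show "p = q"
      using p q pq by auto
  qed
  moreover have "?x p \<in> B" if "p \<in> ?I" for p
  proof -
    have "(\<phi> ^^ m) u \<in> insert \<zero>\<^bsub>M\<^esub> B" if "u \<in> chain_tops B" for u m
      using chain_closed_funpow[OF B(1)] that by (auto simp: chain_tops_def)
    then show ?thesis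
      using that nz[OF that] hT by force
  qed
  moreover have "b \<in> ?x ` ?I" if b: "b \<in> B" for b
  proof -
    obtain u i where u: "u \<in> chain_tops B" "b = (\<phi> ^^ i) u"
      using chain_surj[OF b B(2) nil] .
    have "u \<in> h ` T"
      using bij_betw_imp_surj_on[OF h] u(1) by simp
    then obtain t where t: "t \<in> T" "h t = u"
      by (elim imageE) simp
    have "i < chain_length u"
      using len[OF u(1), of i] u(2) b B(2) by auto
    then have I: "(t, chain_length u - i) \<in> ?I" and eq: "b = ?x (t, chain_length u - i)"
      using t u by auto
    show ?thesis
      using eq I by (rule image_eqI)
  qed
  ultimately show ?thesis
    by (auto simp: bij_betw_def)
qed

text \<open>Spans of unions of cyclic submodules are spans of their generators, and by simplicity a cyclic
  summand that is not contained in the sum of the others meets it only in zero.\<close>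
lemma independent_internal_direct_sum:
  assumes B: "B \<subseteq> simple_vectors" "independent_over {} B" "span B = carrier M"
    and x: "bij_betw x I B"
  shows "internal_direct_sum R M (\<lambda>p. cyclic_submodule R M (x p)) I"
proof -
  have Bc: "B \<subseteq> carrier M"
    using B(1) simple_vectors_carrier by auto
  have xB: "x p \<in> B" if "p \<in> I" for p
    using x that by (auto simp: bij_betw_def)
  have cyc: "cyclic_submodule R M (x p) = span {x p}" if "p \<in> I" for p
    using cyclic_submodule_eq_span xB[OF that] Bc by auto
  have span_UN: "span (\<Union>p\<in>J. cyclic_submodule R M (x p)) = span (x ` J)" if "J \<subseteq> I" for J
  proof
    have xJ: "x ` J \<subseteq> carrier M"
      using xB Bc that by blast
    have "span {x p} \<subseteq> span (x ` J)" if "p \<in> J" for p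
      using that by (intro span_mono) auto
    then show "span (\<Union>p\<in>J. cyclic_submodule R M (x p)) \<subseteq> span (x ` J)"
      using cyc \<open>J \<subseteq> I\<close> by (intro span_subset_span xJ) auto
    have "x p \<in> cyclic_submodule R M (x p)" if "p \<in> J" for p
      using cyc[of p] span_superset[of "{x p}"] that \<open>J \<subseteq> I\<close> by auto
    then show "span (x ` J) \<subseteq> span (\<Union>p\<in>J. cyclic_submodule R M (x p))"
      by (intro span_mono) auto
  qed
  show ?thesis
    unfolding internal_direct_sum_def
  proof (intro conjI ballI)
    fix p assume "p \<in> I"
    then show "submodule (cyclic_submodule R M (x p)) R M"
      using cyc span_submodule[of "{x p}"] xB Bc by auto
  next
    show "span (\<Union>p\<in>I. cyclic_submodule R M (x p)) = carrier M"
      using span_UN[of I] x B(3) by (simp add: bij_betw_def)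
  next
    fix p assume p: "p \<in> I"
    let ?S = "span (B - {x p})"
    have "x ` (I - {p}) = B - {x p}"
      using x p by (auto simp: bij_betw_def inj_on_def)
    then have eq: "span (\<Union>q\<in>I - {p}. cyclic_submodule R M (x q)) = ?S"
      using span_UN[of "I - {p}"] by auto
    have S: "submodule ?S R M"
      using Bc by (intro span_submodule) auto
    have xp: "x p \<in> simple_vectors" "x p \<notin> ?S"
      using xB[OF p] B(1,2) by (auto simp: independent_over_def)
    have "y = \<zero>\<^bsub>M\<^esub>" if y: "y \<in> cyclic_submodule R M (x p)" "y \<in> ?S" for y
      using y simple_vector_multiple_in_submodule[OF xp(1) S xp(2)]
      by (auto simp: cyclic_submodule_def)
    moreover have "\<zero>\<^bsub>M\<^esub> \<in> cyclic_submodule R M (x p)"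
      using cyc[OF p] submodule_zero[OF span_submodule[of "{x p}"]] xB[OF p] Bc by auto
    ultimately show "cyclic_submodule R M (x p) \<inter>
        span (\<Union>q\<in>I - {p}. cyclic_submodule R M (x q)) = {\<zero>\<^bsub>M\<^esub>}"
      unfolding eq using submodule_zero[OF S] by blast
  qed
qed

end

theorem theorem3p1:
  fixes R :: "('a, 'r) ring_scheme"
    and M :: "('a, 'm, 'x) module_scheme"
    and \<phi> :: "'m \<Rightarrow> 'm"
  assumes "left_module R M"
    and "finitely_generated_module R M"
    and "semisimple_module R M"
    and "module_endomorphism R M \<phi>"
    and "nilpotent_on_module M \<phi>"
  shows "\<exists>(r::nat) (k :: nat \<Rightarrow> nat) (x :: nat \<Rightarrow> nat \<Rightarrow> 'm).
    1 \<le> r \<and> (\<forall>t\<in>{1..r}. 1 \<le> k t) \<and>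
    (\<forall>t\<in>{1..r}. \<forall>i\<in>{1..k t}.
       x t i \<in> carrier M \<and> simple_submodule R M (cyclic_submodule R M (x t i))) \<and>
    internal_direct_sum R M (\<lambda>(t, i). cyclic_submodule R M (x t i)) (SIGMA t:{1..r}. {1..k t}) \<and>
    (\<forall>t\<in>{1..r}. \<phi> (x t 1) = \<zero>\<^bsub>M\<^esub> \<and> (\<forall>i\<in>{2..k t}. \<phi> (x t i) = x t (i - 1)))"
proof -
  interpret left_module_endomorphism R M \<phi>
    using assms by (simp add: left_module_endomorphism_def left_module_endomorphism_axioms_def)
  obtain n where zero: "\<And>x. x \<in> carrier M \<Longrightarrow> (\<phi> ^^ Suc n) x = \<zero>\<^bsub>M\<^esub>"
    and nonzero: "\<exists>x\<in>carrier M. (\<phi> ^^ n) x \<noteq> \<zero>\<^bsub>M\<^esub>"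
    using assms(5) unfolding nilpotent_on_module_def
    by (metis Suc_diff_le diff_Suc_1 diff_Suc_Suc One_nat_def minus_nat.diff_0)
  have K: "kernel_power (Suc n) = carrier M"
    using zero by (auto simp: kernel_power_def)
  obtain B where B: "B \<subseteq> simple_vectors" "independent_over {} B" "span B = carrier M"
    and chain: "chain_closed B"
    using chain_closed_basis_of_kernel[of "{}" n] semisimple_span_simple_vectors[OF assms(3)] K
    by (auto simp: independent_over_def)
  have Bc: "B \<subseteq> carrier M" and B0: "\<zero>\<^bsub>M\<^esub> \<notin> B"
    using B(1) simple_vectors_iff by auto
  have nil: "(\<phi> ^^ Suc n) x = \<zero>\<^bsub>M\<^esub>" if "x \<in> B" for x
    using zero Bc that by auto
  have "finite B"
    using finite_independent_span[OF assms(2) Bc B(2,3)] .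
  then have fin: "finite (chain_tops B)"
    by (simp add: chain_tops_def)
  define r where "r = card (chain_tops B)"
  obtain h where h: "bij_betw h {1..r} (chain_tops B)"
    using ex_bij_betw_nat_finite_1[OF fin] by (auto simp: r_def)
  define k where "k t = chain_length (h t)" for t
  define x where "x t i = (\<phi> ^^ (k t - i)) (h t)" for t i
  have bij: "bij_betw (\<lambda>(t, i). x t i) (SIGMA t:{1..r}. {1..k t}) B"
    using chains_bij_betw[OF chain B0 nil h] by (simp add: x_def k_def)
  have xB: "x t i \<in> B" if "t \<in> {1..r}" "i \<in> {1..k t}" for t i
    using bij_betwE[OF bij] that by auto
  have hT: "h t \<in> B" if "t \<in> {1..r}" for t
    using bij_betwE[OF h] that by (auto simp: chain_tops_def)
  have len: "(\<phi> ^^ i) (h t) = \<zero>\<^bsub>M\<^esub> \<longleftrightarrow> k t \<le> i" if "t \<in> {1..r}" for t i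
    unfolding k_def by (rule chain_length_iff[OF nil[OF hT[OF that]]])
  have k: "1 \<le> k t" if "t \<in> {1..r}" for t
    using len[OF that, of 0] hT[OF that] B0 by (cases "k t") auto
  have "B \<noteq> {}"
  proof
    assume "B = {}"
    then have "carrier M = {\<zero>\<^bsub>M\<^esub>}"
      using B(3) span_empty by simp
    moreover have "(\<phi> ^^ n) \<zero>\<^bsub>M\<^esub> = \<zero>\<^bsub>M\<^esub>"
      using funpow_zero_mono[of 0 "\<zero>\<^bsub>M\<^esub>" n] by simp
    ultimately show False
      using nonzero by auto
  qed
  then have "chain_tops B \<noteq> {}"
    using chain_surj[OF _ B0 nil] by blast
  then have r: "1 \<le> r"
    using fin by (simp add: r_def Suc_le_eq card_gt_0_iff)
  have simple: "x t i \<in> carrier M \<and> simple_submodule R M (cyclic_submodule R M (x t i))"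
    if "t \<in> {1..r}" "i \<in> {1..k t}" for t i
    using xB[OF that] B(1) by (auto simp: simple_vectors_def)
  have sum: "internal_direct_sum R M (\<lambda>(t, i). cyclic_submodule R M (x t i)) (SIGMA t:{1..r}. {1..k t})"
    using independent_internal_direct_sum[OF B bij] by (simp add: case_prod_unfold)
  have shift: "\<phi> (x t i) = (\<phi> ^^ (k t - (i - 1))) (h t)" if "i \<in> {1..k t}" for t i
  proof -
    have "k t - (i - 1) = Suc (k t - i)"
      using that by auto
    then show ?thesis
      by (simp add: x_def)
  qed
  have "\<phi> (x t 1) = \<zero>\<^bsub>M\<^esub> \<and> (\<forall>i\<in>{2..k t}. \<phi> (x t i) = x t (i - 1))" if t: "t \<in> {1..r}" for t
    using shift[of _ t] k[OF t] len[OF t] by (auto simp: x_def)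
  then show ?thesis
    using r k simple sum by blast
qed

end
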